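(* In the generative model for execution outcomes described in the context, let $s_{j_1}$ be a correct solution and $s_{j_2}$ an incorrect solution. (1) If $u_k$ is a ground truth unit test, then the precision based on this single ground truth test is $$P(\mathcal{B}_{j_1,k}>\mathcal{B}_{j_2,k}) = 1 - P(\text{the incorrect solution } s_{j_2}\text{ passes test }u_k).$$ (2) Let $u_1,\dots,u_m$ be the $m$ generated unit tests and, for $j\in\{j_1,j_2\}$, let $\mathcal{R}_{s_j}=\sum_{l=1}^m \mathcal{B}_{j,l}$ be the aggregated reward. Put $$\mu := p_u(1-p_{01}) - (1-p_u)p_{00}.$$ Then $P(\mathcal{R}_{s_{j_1}}>\mathcal{R}_{s_{j_2}})\to 1$ as $m\to\infty$ if and only if $\mu>0$. (3) Moreover, under the condition $\mu>0$, the reward precision satisfies $$P(\mathcal{R}_{s_{j_1}}>\mathcal{R}_{s_{j_2}})\ \gtrsim\ 1-e^{-\mu^2 m/8}.$$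
   Context: Model. There are candidate solutions $s_j$ and unit tests $u_k$. Executing solution $s_j$ on test $u_k$ gives a binary outcome $\mathcal{B}_{j,k}\in\{0,1\}$, with $\mathcal{B}_{j,k}=1$ meaning that $s_j$ passes $u_k$. Each solution has a correctness indicator $c_s\in\{0,1\}$ and each unit test has a correctness indicator $c_u\in\{0,1\}$ (value $1$ means correct). The correctness of a generated unit test is a Bernoulli random variable with success probability $p_u$, and the generated unit tests are i.i.d. (The correctness of a generated solution is likewise Bernoulli with success probability $p_s$, but here the two solutions $s_{j_1},s_{j_2}$ are fixed, equivalently all probabilities are conditional on $s_{j_1}$ being correct, $c_s=1$, and $s_{j_2}$ being incorrect, $c_s=0$.) Conditional on the correctness $c_s$ of the solution and $c_u$ of the test, the execution outcome is Bernoulli with success (pass) probability $p_{c_s c_u}$, where $p_{11}=1$ (a correct solution always passes a correct test), $p_{10}=0$ (a correct solution never passes an incorrect test), and $p_{01},p_{00}\in[0,1]$ are unknown parameters: $p_{01}$ is the probability that an incorrect solution passes a correct test and $p_{00}$ the probability that an incorrect solution passes an incorrect test. The parameters $p_u,p_{00},p_{01}$ do not depend on $m$. The triples (correctness of $u_k$, $\mathcal{B}_{j_1,k}$, $\mathcal{B}_{j_2,k}$), $k=1,\dots,m$, are i.i.d. across the generated tests. A ground truth unit test is a test that is correct ($c_u=1$). The quantity $P(\mathcal{R}_{s_{j_1}}>\mathcal{R}_{s_{j_2}})$ is called the reward precision. The symbol $\gtrsim$ has its customary meaning: $A\gtrsim B$ means that $A$ is bounded below by $B$ up to a positive constant factor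 not depending on $m$. *)

theory Defs
  imports "HOL-Probability.Probability"
begin

text \<open>\<open>pass_prob p\<^sub>0\<^sub>0 p\<^sub>0\<^sub>1 c\<^sub>s c\<^sub>u\<close> is the probability that a solution of correctness \<open>c\<^sub>s\<close> passes a test
  of correctness \<open>c\<^sub>u\<close>.\<close>

fun pass_prob :: "real \<Rightarrow> real \<Rightarrow> bool \<Rightarrow> bool \<Rightarrow> real" where
  "pass_prob p\<^sub>0\<^sub>0 p\<^sub>0\<^sub>1 True  True  = 1"
| "pass_prob p\<^sub>0\<^sub>0 p\<^sub>0\<^sub>1 True  False = 0"
| "pass_prob p\<^sub>0\<^sub>0 p\<^sub>0\<^sub>1 False True  = p\<^sub>0\<^sub>1"
| "pass_prob p\<^sub>0\<^sub>0 p\<^sub>0\<^sub>1 False False = p\<^sub>0\<^sub>0"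

text \<open>Solutions are fixed, so their correctness is deterministic; the correctness of a test and the
  execution outcomes are random.  The guard in \<open>pass\<close> restricts conditioning to non-null events,
  since \<^const>\<open>cond_prob\<close> takes the value \<open>0\<close> on null ones.\<close>

locale execution_model = prob_space M
  for M :: "'a measure" +
  fixes sol_correct :: "'s \<Rightarrow> bool"
    and test_correct :: "'u \<Rightarrow> 'a \<Rightarrow> bool"
    and outcome :: "'s \<Rightarrow> 'u \<Rightarrow> 'a \<Rightarrow> nat"
    and p\<^sub>0\<^sub>0 p\<^sub>0\<^sub>1 :: real
  assumes test_correct_rv: "\<And>v. random_variable (count_space UNIV) (test_correct v)"
    and outcome_rv: "\<And>j v. random_variable (count_space {0, 1}) (outcome j v)"
    and p00_range: "p\<^sub>0\<^sub>0 \<in> {0..1}"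
    and p01_range: "p\<^sub>0\<^sub>1 \<in> {0..1}"
    and pass: "\<And>j v c. \<P>(\<omega> in M. test_correct v \<omega> = c) > 0 \<Longrightarrow>
      \<P>(\<omega> in M. outcome j v \<omega> = 1 \<bar> test_correct v \<omega> = c) = pass_prob p\<^sub>0\<^sub>0 p\<^sub>0\<^sub>1 (sol_correct j) c"

text \<open>The sequence \<open>u\<close> lists the generated tests.  Tests outside its range, for instance ground truth
  tests that were not generated, are allowed, and nothing is assumed about the probability that they
  are correct.\<close>

locale generated_tests = execution_model M sol_correct test_correct outcome p\<^sub>0\<^sub>0 p\<^sub>0\<^sub>1
  for M :: "'a measure"
    and sol_correct :: "'s \<Rightarrow> bool"
    and test_correct :: "'u \<Rightarrow> 'a \<Rightarrow> bool"
    and outcome :: "'s \<Rightarrow> 'u \<Rightarrow> 'a \<Rightarrow> nat"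
    and p\<^sub>0\<^sub>0 p\<^sub>0\<^sub>1 :: real +
  fixes u :: "nat \<Rightarrow> 'u"
    and p\<^sub>u :: real
    and j\<^sub>1 j\<^sub>2 :: 's
  assumes generated_correct: "\<And>k. \<P>(\<omega> in M. test_correct (u k) \<omega>) = p\<^sub>u"
    and triples_indep: "indep_vars (\<lambda>_. count_space UNIV)
      (\<lambda>k \<omega>. (test_correct (u k) \<omega>, outcome j\<^sub>1 (u k) \<omega>, outcome j\<^sub>2 (u k) \<omega>)) UNIV"
    and triples_ident: "\<And>k l.
      distr M (count_space UNIV)
        (\<lambda>\<omega>. (test_correct (u k) \<omega>, outcome j\<^sub>1 (u k) \<omega>, outcome j\<^sub>2 (u k) \<omega>)) =
      distr M (count_space UNIV)
        (\<lambda>\<omega>. (test_correct (u l) \<omega>, outcome j\<^sub>1 (u l) \<omega>, outcome j\<^sub>2 (u l) \<omega>))"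

text \<open>The first \<open>m\<close> generated tests are \<open>u 0, \<dots>, u (m - 1)\<close>.\<close>

definition reward :: "('s \<Rightarrow> 'u \<Rightarrow> 'a \<Rightarrow> nat) \<Rightarrow> (nat \<Rightarrow> 'u) \<Rightarrow> nat \<Rightarrow> 's \<Rightarrow> 'a \<Rightarrow> nat" where
  "reward outcome u m j \<omega> = (\<Sum>l<m. outcome j (u l) \<omega>)"

end

theory Submission imports Defs begin

text \<open>The reward difference is a sum of i.i.d. gaps with values in \<open>{-1, 0, 1}\<close> and mean \<open>\<mu>\<close>.  For
  \<open>\<mu> > 0\<close>, Hoeffding's inequality bounds the probability that the sum is nonpositive by
  \<open>exp (- \<mu>\<^sup>2 m / 2)\<close>, so part (3) holds with \<open>C = 1\<close>.  For \<open>\<mu> \<le> 0\<close>, either the gaps are almost surely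
  constant, or by the central limit theorem the probability of a nonpositive sum is asymptotically at
  least \<open>\<Phi>(0) > 0\<close>.\<close>

section \<open>Standard normal distribution function and positivity of i.i.d. sums\<close>

text \<open>The normal law has a density, so it has no atoms, and a distribution function is
  continuous wherever there is no atom. This lets weak convergence be evaluated at 0.\<close>

lemma isCont_cdf_std_normal: "isCont (cdf std_normal_distribution) x"
proof -
  interpret real_distribution std_normal_distribution
    by (rule real_dist_normal_dist)
  have "absolutely_continuous lborel std_normal_distribution"
    by (rule absolutely_continuousI_density) simp
  moreover have "{x} \<in> null_sets lborel"
    by (simp add: null_sets_def)
  ultimately have "{x} \<in> null_sets std_normal_distribution"
    by (auto simp: absolutely_continuous_def)
  then show ?thesis
    by (simp add: isCont_cdf measure_eq_0_null_sets)
qed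

text \<open>The density vanishes nowhere, so a half-line of normal measure 0 would be Lebesgue null;
  but it contains an interval of length 1.\<close>

lemma cdf_std_normal_pos: "0 < cdf std_normal_distribution x"
proof (rule ccontr)
  interpret real_distribution std_normal_distribution
    by (rule real_dist_normal_dist)
  assume "\<not> ?thesis"
  with cdf_nonneg[of x] have "cdf std_normal_distribution x = 0"
    by simp
  then have "emeasure std_normal_distribution {..x} = 0"
    by (simp add: cdf_def emeasure_eq_measure)
  then have "AE y in lborel. y \<notin> {..x}"
    by (subst (asm) emeasure_density)
       (auto simp: nn_integral_0_iff_AE indicator_def normal_density_def elim!: AE_mp split: if_splits)
  then have "emeasure lborel {x-1..x} = emeasure lborel ({} :: real set)"
    by (intro emeasure_eq_AE) auto
  then show False
    by simp
qed

text \<open>The central limit theorem needs positive variance, hence the case split on the variance.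
  In the nondegenerate case a negative mean needs no separate treatment: it only enlarges the event
  that the sum is nonpositive.\<close>

lemma (in prob_space) prob_sum_pos_not_tendsto_1:
  fixes X :: "nat \<Rightarrow> 'a \<Rightarrow> real"
  assumes indep: "indep_vars (\<lambda>_. borel) X UNIV"
    and ident: "\<And>n. distr M borel (X n) = distr M borel (X 0)"
    and sq: "integrable M (\<lambda>\<omega>. (X 0 \<omega>)\<^sup>2)"
    and mean: "expectation (X 0) \<le> 0"
  shows "\<not> (\<lambda>n. \<P>(\<omega> in M. (\<Sum>i<n. X i \<omega>) > 0)) \<longlonglongrightarrow> 1"
proof
  assume lim: "(\<lambda>n. \<P>(\<omega> in M. (\<Sum>i<n. X i \<omega>) > 0)) \<longlonglongrightarrow> 1"
  have rv [measurable]: "random_variable borel (X n)" for n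
    using indep by (auto simp: indep_vars_def)
  have int: "integrable M (X 0)"
    using sq by (rule square_integrable_imp_integrable[OF rv])
  \<comment> \<open>Integrals of Borel functions of \<open>X n\<close> depend only on its law.
    Applied below to the identity, the square and the squared deviation from
    \<open>a\<close>.\<close>
  have transfer_int: "integrable M (\<lambda>\<omega>. g (X n \<omega>)) \<longleftrightarrow> integrable M (\<lambda>\<omega>. g (X 0 \<omega>))"
    and transfer_expectation: "expectation (\<lambda>\<omega>. g (X n \<omega>)) = expectation (\<lambda>\<omega>. g (X 0 \<omega>))"
    if "g \<in> borel_measurable borel" for n and g :: "real \<Rightarrow> real"
    using ident[of n] that
    by (simp_all flip: integrable_distr_eq[of "X _" M borel g] integral_distr[of "X _" M borel g])
  define a where "a = expectation (X 0)"
  have mean_n: "expectation (X n) = a" for n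
    using transfer_expectation[of "\<lambda>x. x" n] by (simp add: a_def)
  define v where "v = variance (X 0)"
  have var_n: "variance (X n) = v" for n
    using transfer_expectation[of "\<lambda>x. (x - a)\<^sup>2" n] by (simp add: mean_n v_def)
  show False
  proof (cases "v = 0")
    case True
    have sq': "integrable M (\<lambda>\<omega>. (X 0 \<omega> - a)\<^sup>2)"
      using sq int by (simp add: power2_diff)
    have "AE \<omega> in M. X n \<omega> = a" for n
    proof -
      have "integrable M (\<lambda>\<omega>. (X n \<omega> - a)\<^sup>2)"
        using sq' transfer_int[of "\<lambda>x. (x - a)\<^sup>2" n] by simp
      moreover have "expectation (\<lambda>\<omega>. (X n \<omega> - a)\<^sup>2) = 0"
        using var_n[of n] True by (simp add: mean_n)
      ultimately show ?thesis
        by (subst (asm) integral_nonneg_eq_0_iff_AE) auto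
    qed
    \<comment> \<open>One null set serves for all indices at once, so almost surely every partial
      sum equals \<open>n * a\<close>, which is nonpositive.\<close>
    then have ae: "AE \<omega> in M. \<forall>n. X n \<omega> = a"
      by (simp add: AE_all_countable)
    have "\<P>(\<omega> in M. (\<Sum>i<n. X i \<omega>) > 0) = 0" for n
    proof -
      have "AE \<omega> in M. \<not> (\<Sum>i<n. X i \<omega>) > 0"
        using ae
        by eventually_elim (use mean in \<open>auto simp: a_def not_less mult_nonneg_nonpos\<close>)
      then show ?thesis
        by (subst prob_eq_0) auto
    qed
    with lim show False
      by (simp add: LIMSEQ_const_iff)
  next
    case False
    define \<sigma> where "\<sigma> = sqrt v"
    have v: "v > 0"
      using False variance_positive[of "X 0"] by (simp add: v_def order_less_le)
    then have \<sigma>: "\<sigma> > 0" "\<sigma>\<^sup>2 = v"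
      by (simp_all add: \<sigma>_def)
    let ?Z = "\<lambda>n \<omega>. (\<Sum>i<n. X i \<omega> - a) / sqrt (real n * \<sigma>\<^sup>2)"
    have "weak_conv_m (\<lambda>n. distr M borel (?Z n)) std_normal_distribution"
    proof (rule central_limit_theorem)
      show "integrable M (\<lambda>\<omega>. (X n \<omega>)\<^sup>2)" for n
        using transfer_int[of "\<lambda>x. x\<^sup>2" n] sq by simp
    qed (use indep mean_n var_n \<sigma> ident in auto)
    then have "(\<lambda>n. cdf (distr M borel (?Z n)) 0) \<longlonglongrightarrow> cdf std_normal_distribution 0"
      using isCont_cdf_std_normal by (auto simp: weak_conv_m_def weak_conv_def)
    moreover have "(\<lambda>n. 1 - \<P>(\<omega> in M. (\<Sum>i<n. X i \<omega>) > 0)) \<longlonglongrightarrow> 1 - 1"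
      by (intro tendsto_intros lim)
    moreover have "eventually (\<lambda>n. cdf (distr M borel (?Z n)) 0
        \<le> 1 - \<P>(\<omega> in M. (\<Sum>i<n. X i \<omega>) > 0)) sequentially"
      using eventually_gt_at_top[of 0]
    proof eventually_elim
      case (elim n)
      \<comment> \<open>For \<open>n > 0\<close> the denominator of \<open>?Z n\<close> is positive,
        so \<open>?Z n \<omega> \<le> 0\<close> says that the sum is at most its mean
        \<open>n * a\<close>.\<close>
      have "(\<Sum>i<n. X i \<omega>) \<le> 0" if "?Z n \<omega> \<le> 0" for \<omega>
      proof -
        have "(\<Sum>i<n. X i \<omega>) \<le> real n * a"
          using that elim v \<sigma> by (simp add: divide_le_0_iff mult_le_0_iff sum_subtractf)
        also have "\<dots> \<le> 0"
          using mean by (simp add: a_def mult_nonneg_nonpos)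
        finally show ?thesis .
      qed
      then have "prob {\<omega>\<in>space M. ?Z n \<omega> \<le> 0} \<le> prob {\<omega>\<in>space M. \<not> (\<Sum>i<n. X i \<omega>) > 0}"
        by (intro finite_measure_mono) (auto simp: not_less)
      also have "\<dots> = 1 - \<P>(\<omega> in M. (\<Sum>i<n. X i \<omega>) > 0)"
        by (rule prob_neg) auto
      finally show ?case
        by (simp add: cdf_def measure_distr vimage_def Int_def conj_commute)
    qed
    \<comment> \<open>The comparison passes to the limit, where the assumed convergence makes the
      right-hand side 0.\<close>
    ultimately have "cdf std_normal_distribution 0 \<le> 1 - 1"
      by (intro tendsto_le[OF sequentially_bot]) auto
    with cdf_std_normal_pos[of 0] show False
      by simp
  qed
qed

section \<open>A single test: pass probabilities and ground truth precision\<close>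

context execution_model
begin

lemma test_correct_measurable [measurable]: "test_correct v \<in> measurable M (count_space UNIV)"
  by (rule test_correct_rv)

lemma outcome_measurable [measurable]: "outcome j v \<in> measurable M (count_space UNIV)"
  by (rule measurable_compose[OF outcome_rv]) auto

lemma outcome_borel_measurable [measurable]: "outcome j v \<in> borel_measurable M"
  by (rule measurable_compose[OF outcome_rv]) auto

lemma outcome_cases: "\<omega> \<in> space M \<Longrightarrow> outcome j v \<omega> = 0 \<or> outcome j v \<omega> = 1"
  using measurable_space[OF outcome_rv, of \<omega> j v] by auto

text \<open>The product form of \<open>pass\<close>. It also covers a null conditioning event, where
  both sides are 0, so later computations need no case split.\<close>

lemma prob_pass_conj:
  "\<P>(\<omega> in M. outcome j v \<omega> = 1 \<and> test_correct v \<omega> = c) =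
    pass_prob p\<^sub>0\<^sub>0 p\<^sub>0\<^sub>1 (sol_correct j) c * \<P>(\<omega> in M. test_correct v \<omega> = c)"
proof (cases "\<P>(\<omega> in M. test_correct v \<omega> = c) > 0")
  case True
  then show ?thesis
    using pass[OF True, of j] by (simp add: cond_prob_def field_simps)
next
  case False
  then have zero: "\<P>(\<omega> in M. test_correct v \<omega> = c) = 0"
    by (simp add: zero_less_measure_iff)
  have "\<P>(\<omega> in M. outcome j v \<omega> = 1 \<and> test_correct v \<omega> = c) \<le> \<P>(\<omega> in M. test_correct v \<omega> = c)"
    by (rule finite_measure_mono) auto
  with zero show ?thesis
    by (simp add: measure_le_0_iff)
qed

text \<open>A binary outcome is the indicator of passing; its expectation follows by total
  probability over the correctness of the test.\<close>

lemma expectation_outcome: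
  "expectation (\<lambda>\<omega>. real (outcome j v \<omega>)) =
    (let q = \<P>(\<omega> in M. test_correct v \<omega>) in
      pass_prob p\<^sub>0\<^sub>0 p\<^sub>0\<^sub>1 (sol_correct j) True * q + pass_prob p\<^sub>0\<^sub>0 p\<^sub>0\<^sub>1 (sol_correct j) False * (1 - q))"
proof -
  have "expectation (\<lambda>\<omega>. real (outcome j v \<omega>)) =
      expectation (indicator {\<omega>\<in>space M. outcome j v \<omega> = 1})"
    by (rule Bochner_Integration.integral_cong) (use outcome_cases in \<open>force simp: indicator_def\<close>)+
  also have "\<dots> = \<P>(\<omega> in M. outcome j v \<omega> = 1)"
    by simp
  also have "\<dots> = \<P>(\<omega> in M. outcome j v \<omega> = 1 \<and> test_correct v \<omega> = True) +
      \<P>(\<omega> in M. outcome j v \<omega> = 1 \<and> test_correct v \<omega> = False)"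
    by (subst finite_measure_Union[symmetric]) (auto intro!: arg_cong[where f = prob])
  also have "\<P>(\<omega> in M. test_correct v \<omega> = False) = 1 - \<P>(\<omega> in M. test_correct v \<omega>)"
    by (simp add: prob_neg)
  then have "\<P>(\<omega> in M. outcome j v \<omega> = 1 \<and> test_correct v \<omega> = True) +
      \<P>(\<omega> in M. outcome j v \<omega> = 1 \<and> test_correct v \<omega> = False) =
    (let q = \<P>(\<omega> in M. test_correct v \<omega>) in
      pass_prob p\<^sub>0\<^sub>0 p\<^sub>0\<^sub>1 (sol_correct j) True * q + pass_prob p\<^sub>0\<^sub>0 p\<^sub>0\<^sub>1 (sol_correct j) False * (1 - q))"
    unfolding prob_pass_conj Let_def by simp
  finally show ?thesis .
qed

text \<open>As \<open>pass_prob\<close> is 1 for a correct solution on a correct test,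
  \<open>j\<close> passes almost surely whenever \<open>v\<close> is correct. On that event the
  strict inequality fails exactly when \<open>j'\<close> passes.\<close>

lemma ground_truth_precision:
  assumes "sol_correct j" and pos: "\<P>(\<omega> in M. test_correct v \<omega>) > 0"
  shows "\<P>(\<omega> in M. outcome j v \<omega> > outcome j' v \<omega> \<bar> test_correct v \<omega>) =
    1 - \<P>(\<omega> in M. outcome j' v \<omega> = 1 \<bar> test_correct v \<omega>)"
proof -
  let ?c = "\<P>(\<omega> in M. test_correct v \<omega>)"
  have eq: "\<P>(\<omega> in M. outcome j v \<omega> = 1 \<and> test_correct v \<omega>) = ?c"
    using prob_pass_conj[of j v True] assms by simp
  have "?c - \<P>(\<omega> in M. outcome j v \<omega> = 1 \<and> test_correct v \<omega>) =
      prob ({\<omega>\<in>space M. test_correct v \<omega>} - {\<omega>\<in>space M. outcome j v \<omega> = 1 \<and> test_correct v \<omega>})"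
    by (rule finite_measure_Diff[symmetric]) auto
  then have "AE \<omega> in M. \<omega> \<notin> {\<omega>\<in>space M. test_correct v \<omega>} - {\<omega>\<in>space M. outcome j v \<omega> = 1 \<and> test_correct v \<omega>}"
    using eq by (subst prob_eq_0[symmetric]) auto
  then have ae: "AE \<omega> in M. test_correct v \<omega> \<longrightarrow> outcome j v \<omega> = 1"
    by (auto elim!: AE_mp)
  \<comment> \<open>Repeating \<open>test_correct\<close> under the negation presents the event as a
    set minus one of its subsets, so that the probabilities subtract.\<close>
  have "\<P>(\<omega> in M. outcome j v \<omega> > outcome j' v \<omega> \<and> test_correct v \<omega>) =
      \<P>(\<omega> in M. test_correct v \<omega> \<and> \<not> (outcome j' v \<omega> = 1 \<and> test_correct v \<omega>))"
  proof (rule prob_eq_AE)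
    show "AE \<omega> in M. (outcome j v \<omega> > outcome j' v \<omega> \<and> test_correct v \<omega>) \<longleftrightarrow>
        (test_correct v \<omega> \<and> \<not> (outcome j' v \<omega> = 1 \<and> test_correct v \<omega>))"
      using ae AE_space by eventually_elim (use outcome_cases in force)
  qed auto
  also have "{\<omega>\<in>space M. test_correct v \<omega> \<and> \<not> (outcome j' v \<omega> = 1 \<and> test_correct v \<omega>)} =
      {\<omega>\<in>space M. test_correct v \<omega>} - {\<omega>\<in>space M. outcome j' v \<omega> = 1 \<and> test_correct v \<omega>}"
    by auto
  also have "prob \<dots> = ?c - \<P>(\<omega> in M. outcome j' v \<omega> = 1 \<and> test_correct v \<omega>)"
    by (rule finite_measure_Diff) auto
  finally show ?thesis
    using pos by (simp add: cond_prob_def diff_divide_distrib)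
qed

end

section \<open>Outcome gaps on the generated tests: independence, law and mean\<close>

context generated_tests
begin

text \<open>Real-valued because subtraction of natural numbers would truncate the case where only
  \<open>j\<^sub>2\<close> passes. Comparing two rewards becomes a question about the sign of one
  sum.\<close>

definition gap :: "nat \<Rightarrow> 'a \<Rightarrow> real" where
  "gap k \<omega> = real (outcome j\<^sub>1 (u k) \<omega>) - real (outcome j\<^sub>2 (u k) \<omega>)"

lemma gap_measurable [measurable]: "gap k \<in> borel_measurable M"
  unfolding gap_def[abs_def] by measurable

lemma gap_range: "\<omega> \<in> space M \<Longrightarrow> gap k \<omega> \<in> {-1..1}"
  using outcome_cases[of \<omega> j\<^sub>1 "u k"] outcome_cases[of \<omega> j\<^sub>2 "u k"] by (auto simp: gap_def)

lemma indep_gap: "indep_vars (\<lambda>_. borel) gap UNIV"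
  using indep_vars_compose2[OF triples_indep, of "\<lambda>_ (_, a, b). real a - real b" "\<lambda>_. borel"]
  by (simp add: gap_def[abs_def])

text \<open>Each gap is the same function of its triple, so its law is the image of the common law
  of the triples.\<close>

lemma distr_gap: "distr M borel (gap k) = distr M borel (gap l)"
proof -
  have "distr M borel (gap k) =
      distr (distr M (count_space UNIV)
        (\<lambda>\<omega>. (test_correct (u k) \<omega>, outcome j\<^sub>1 (u k) \<omega>, outcome j\<^sub>2 (u k) \<omega>)))
        borel (\<lambda>(_, a, b). real a - real b)" for k
    using triples_indep by (subst distr_distr) (auto simp: indep_vars_def gap_def[abs_def] o_def)
  then show ?thesis
    using triples_ident[of k l] by simp
qed

text \<open>By linearity the two marginal means suffice: \<open>p\<^sub>u\<close> for the correct
  solution and \<open>p\<^sub>0\<^sub>1 * p\<^sub>u + p\<^sub>0\<^sub>0 * (1 - p\<^sub>u)\<close>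
  for the incorrect one.\<close>

lemma expectation_gap:
  assumes "sol_correct j\<^sub>1" "\<not> sol_correct j\<^sub>2"
  shows "expectation (gap k) = p\<^sub>u * (1 - p\<^sub>0\<^sub>1) - (1 - p\<^sub>u) * p\<^sub>0\<^sub>0"
proof -
  have int: "integrable M (\<lambda>\<omega>. real (outcome j v \<omega>))" for j v
    by (rule integrable_const_bound[of _ 1]) (use outcome_cases[of _ j v] in force)+
  have "expectation (gap k) =
      expectation (\<lambda>\<omega>. real (outcome j\<^sub>1 (u k) \<omega>)) - expectation (\<lambda>\<omega>. real (outcome j\<^sub>2 (u k) \<omega>))"
    unfolding gap_def[abs_def] by (rule Bochner_Integration.integral_diff[OF int int])
  then show ?thesis
    using assms by (simp add: expectation_outcome generated_correct Let_def algebra_simps)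
qed

section \<open>Hoeffding bound and limit of the reward precision\<close>

lemma reward_less_iff:
  "reward outcome u m j\<^sub>2 \<omega> < reward outcome u m j\<^sub>1 \<omega> \<longleftrightarrow> (\<Sum>k<m. gap k \<omega>) > 0"
  by (simp add: reward_def gap_def sum_subtractf flip: of_nat_sum)

lemma prob_sum_gap_nonpos_le:
  assumes "sol_correct j\<^sub>1" "\<not> sol_correct j\<^sub>2"
    and "\<mu> = p\<^sub>u * (1 - p\<^sub>0\<^sub>1) - (1 - p\<^sub>u) * p\<^sub>0\<^sub>0" and "\<mu> > 0" and "m > 0"
  shows "\<P>(\<omega> in M. (\<Sum>k<m. gap k \<omega>) \<le> 0) \<le> exp (- \<mu>\<^sup>2 * real m / 2)"
proof -
  interpret Hoeffding_ineq M "{..<m}" gap "\<lambda>_. -1" "\<lambda>_. 1" "\<Sum>k<m. expectation (gap k)"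
  proof unfold_locales
    show "indep_vars (\<lambda>_. borel) gap {..<m}"
      by (rule indep_vars_subset[OF indep_gap]) auto
    show "AE \<omega> in M. gap k \<omega> \<in> {-1..1}" for k
      by (rule AE_I2) (rule gap_range)
  qed auto
  have sum: "(\<Sum>k<m. expectation (gap k)) = real m * \<mu>"
    using assms by (simp add: expectation_gap)
  \<comment> \<open>The deviation is the whole mean \<open>real m * \<mu>\<close>. Each gap ranges
    over an interval of length 2, so the squared lengths add up to \<open>real m * 4\<close>, which
    is positive as \<open>m > 0\<close>.\<close>
  have "\<P>(\<omega> in M. (\<Sum>k<m. gap k \<omega>) \<le> 0) \<le> exp (-2 * (real m * \<mu>)\<^sup>2 / (real m * 4))"
    using Hoeffding_ineq_le[of "real m * \<mu>"] assms unfolding sum by simp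
  also have "-2 * (real m * \<mu>)\<^sup>2 / (real m * 4) = - \<mu>\<^sup>2 * real m / 2"
    using \<open>m > 0\<close> by (simp add: power2_eq_square field_simps)
  finally show ?thesis .
qed

text \<open>Complement of the Hoeffding bound, with the exponent weakened from 1/2 to 1/8. For
  \<open>m = 0\<close> the right-hand side is 0.\<close>

lemma reward_precision_ge:
  assumes "sol_correct j\<^sub>1" "\<not> sol_correct j\<^sub>2"
    and "\<mu> = p\<^sub>u * (1 - p\<^sub>0\<^sub>1) - (1 - p\<^sub>u) * p\<^sub>0\<^sub>0" and "\<mu> > 0"
  shows "\<P>(\<omega> in M. reward outcome u m j\<^sub>1 \<omega> > reward outcome u m j\<^sub>2 \<omega>) \<ge>
    1 - exp (- \<mu>\<^sup>2 * real m / 8)"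
proof (cases "m > 0")
  case True
  have "\<P>(\<omega> in M. (\<Sum>k<m. gap k \<omega>) > 0) = 1 - \<P>(\<omega> in M. (\<Sum>k<m. gap k \<omega>) \<le> 0)"
    by (subst prob_neg[symmetric]) (auto simp: not_le)
  moreover have "exp (- \<mu>\<^sup>2 * real m / 2) \<le> exp (- \<mu>\<^sup>2 * real m / 8)"
    by (simp add: field_simps)
  ultimately show ?thesis
    using prob_sum_gap_nonpos_le[OF assms True] unfolding reward_less_iff by linarith
qed auto

lemma reward_precision_tendsto_1_iff:
  assumes "sol_correct j\<^sub>1" "\<not> sol_correct j\<^sub>2"
    and \<mu>: "\<mu> = p\<^sub>u * (1 - p\<^sub>0\<^sub>1) - (1 - p\<^sub>u) * p\<^sub>0\<^sub>0"
  shows "(\<lambda>m. \<P>(\<omega> in M. reward outcome u m j\<^sub>1 \<omega> > reward outcome u m j\<^sub>2 \<omega>)) \<longlonglongrightarrow> 1 \<longleftrightarrow> \<mu> > 0"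
proof
  assume "\<mu> > 0"
  show "(\<lambda>m. \<P>(\<omega> in M. reward outcome u m j\<^sub>1 \<omega> > reward outcome u m j\<^sub>2 \<omega>)) \<longlonglongrightarrow> 1"
  proof (rule tendsto_sandwich[where h = "\<lambda>_. 1"])
    \<comment> \<open>The error term is a geometric sequence, with ratio below 1 because \<mu> is
      nonzero.\<close>
    have "(\<lambda>m. exp (- \<mu>\<^sup>2 / 8) ^ m) \<longlonglongrightarrow> 0"
      using \<open>\<mu> > 0\<close> by (intro LIMSEQ_realpow_zero) auto
    then have "(\<lambda>m. 1 - exp (- \<mu>\<^sup>2 / 8) ^ m) \<longlonglongrightarrow> 1 - 0"
      by (rule tendsto_diff[OF tendsto_const])
    then show "(\<lambda>m. 1 - exp (- \<mu>\<^sup>2 * real m / 8)) \<longlonglongrightarrow> 1"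
      by (simp add: mult.commute flip: exp_of_nat_mult)
  qed (use reward_precision_ge[OF assms \<open>\<mu> > 0\<close>] in \<open>auto intro!: always_eventually\<close>)
next
  assume lim: "(\<lambda>m. \<P>(\<omega> in M. reward outcome u m j\<^sub>1 \<omega> > reward outcome u m j\<^sub>2 \<omega>)) \<longlonglongrightarrow> 1"
  \<comment> \<open>Boundedness of the gaps supplies the second moment; a nonpositive mean would
    then contradict \<open>lim\<close>.\<close>
  have "integrable M (\<lambda>\<omega>. (gap 0 \<omega>)\<^sup>2)"
  proof (rule integrable_const_bound)
    show "AE \<omega> in M. norm ((gap 0 \<omega>)\<^sup>2) \<le> 1"
      using gap_range[of _ 0] by (intro AE_I2) (auto simp: abs_square_le_1 abs_le_iff)
  qed simp
  then have "\<not> expectation (gap 0) \<le> 0"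
    using prob_sum_pos_not_tendsto_1[OF indep_gap distr_gap] lim by (auto simp: reward_less_iff)
  then show "\<mu> > 0"
    using assms by (simp add: expectation_gap)
qed

end

theorem theorem3p1:
  fixes M :: "'a measure"
    and sol_correct :: "'s \<Rightarrow> bool"
    and test_correct :: "'u \<Rightarrow> 'a \<Rightarrow> bool"
    and outcome :: "'s \<Rightarrow> 'u \<Rightarrow> 'a \<Rightarrow> nat"
    and p\<^sub>0\<^sub>0 p\<^sub>0\<^sub>1 p\<^sub>u \<mu> :: real
    and u :: "nat \<Rightarrow> 'u"
    and j\<^sub>1 j\<^sub>2 :: 's
  assumes model: "generated_tests M sol_correct test_correct outcome p\<^sub>0\<^sub>0 p\<^sub>0\<^sub>1 u p\<^sub>u j\<^sub>1 j\<^sub>2"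
    and correct: "sol_correct j\<^sub>1"
    and incorrect: "\<not> sol_correct j\<^sub>2"
    and mu: "\<mu> = p\<^sub>u * (1 - p\<^sub>0\<^sub>1) - (1 - p\<^sub>u) * p\<^sub>0\<^sub>0"
  shows "(\<forall>v. \<P>(\<omega> in M. test_correct v \<omega>) > 0 \<longrightarrow>
            \<P>(\<omega> in M. outcome j\<^sub>1 v \<omega> > outcome j\<^sub>2 v \<omega> \<bar> test_correct v \<omega>) =
              1 - \<P>(\<omega> in M. outcome j\<^sub>2 v \<omega> = 1 \<bar> test_correct v \<omega>))
       \<and> ((\<lambda>m. \<P>(\<omega> in M. reward outcome u m j\<^sub>1 \<omega> > reward outcome u m j\<^sub>2 \<omega>))
              \<longlonglongrightarrow> 1 \<longleftrightarrow> \<mu> > 0)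
       \<and> (\<mu> > 0 \<longrightarrow>
            (\<exists>C>0. \<forall>m. \<P>(\<omega> in M. reward outcome u m j\<^sub>1 \<omega> > reward outcome u m j\<^sub>2 \<omega>)
                        \<ge> C * (1 - exp (- \<mu>\<^sup>2 * real m / 8))))"
  proof -
  interpret generated_tests M sol_correct test_correct outcome p\<^sub>0\<^sub>0 p\<^sub>0\<^sub>1 u p\<^sub>u j\<^sub>1 j\<^sub>2
    by (rule model)
  show ?thesis
    using ground_truth_precision[OF correct] reward_precision_tendsto_1_iff[OF correct incorrect mu]
      reward_precision_ge[OF correct incorrect mu]
    by (auto intro!: exI[of _ 1])
qed

end
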